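(* Let $\mathcal U$ be a fixed ultrafilter on $\mathbb N$ and let $\mathbb{IIR}=(\mathbb N\to\mathbb Z^{\mathbb N})_{\sigma\tau}$ be the ordered field of Eudoxus hyperreals constructed from $\mathcal U$, i.e. the set of functions $(a,n)\mapsto u^a_n\in\mathbb Z$ such that $a\mapsto u^a_n$ is an almost homomorphism for each $n\in\mathbb N$, modulo the equivalence relation $\sim_{\sigma\tau}$ (see context). Then there is a natural inclusion $\mathbb R\hookrightarrow \mathbb{IIR}$, sending $r\in\mathbb R$ to the class of the function $u_n^a=\lfloor ra\rfloor$ (constant in $n$), and this is an embedding of ordered fields. Furthermore, $\mathbb{IIR}$ is isomorphic, as an ordered field, to the ultrapower ${}^*\mathbb R=\mathbb R^{\mathbb N}/\mathcal U$.
   Context: A function $f:\mathbb Z\to\mathbb Z$ is an almost homomorphism if $(p,q)\mapsto f(p+q)-f(p)-f(q)$ has bounded range on $\mathbb Z\times\mathbb Z$. Let $B$ be the group of functions $\mathbb Z\to\mathbb Z$ with bounded range. For almost homomorphisms $f,g$ write $f\sim_\sigma g$ iff $f-g\in B$. The set $\mathbb E$ of $\sim_\sigma$-classes $[f]_\sigma$ of almost homomorphisms is a complete ordered field (the Eudoxus reals, isomorphic to $\mathbb R$): addition is induced by pointwise addition, multiplication by composition of almost homomorphisms, and $[f]_\sigma>0$ iff $\sup_{m\in\mathbb N}f(m)=+\infty$. The set $\mathbb{IIR}$: consider all functions $u:\mathbb Z\times\mathbb N\to\mathbb Z$, $(a,n)\mapsto u^a_n$, such that for each fixed $n\in\mathbb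 N$ the map $u_n:a\mapsto u_n^a$ is an almost homomorphism. Put $u\sim_{\sigma\tau}v$ iff $\{n\in\mathbb N: u_n\sim_\sigma v_n\}\in\mathcal U$. Then $\mathbb{IIR}$ is the set of $\sim_{\sigma\tau}$-classes. Addition and multiplication on $\mathbb{IIR}$ are induced, for each fixed $n$, by pointwise addition and by composition in the variable $a$; the class of $u$ is less than the class of $v$ iff $\{n: [u_n]_\sigma<[v_n]_\sigma \text{ in }\mathbb E\}\in\mathcal U$. $\mathbb R^{\mathbb N}/\mathcal U$ is the usual ultrapower: real sequences modulo equality on a set in $\mathcal U$, with the induced ordered field structure. *)

theory Defs
  imports
    "HOL-Analysis.Elementary_Metric_Spaces"
    "HOL-Library.Extended_Real"
    "HOL-Algebra.QuotRing"
begin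

section \<open>Ordered fields as carrier-based structures\<close>

record 'a ordered_ring_rec = "'a ring" +
  lt :: "'a \<Rightarrow> 'a \<Rightarrow> bool" (infix \<open>\<prec>\<index>\<close> 50)

locale ordered_field = field R for R :: "('a, 'm) ordered_ring_rec_scheme" (structure) +
  assumes lt_irrefl: "x \<in> carrier R \<Longrightarrow> \<not> x \<prec> x"
    and lt_trans: "\<lbrakk>x \<in> carrier R; y \<in> carrier R; z \<in> carrier R; x \<prec> y; y \<prec> z\<rbrakk> \<Longrightarrow> x \<prec> z"
    and lt_total: "\<lbrakk>x \<in> carrier R; y \<in> carrier R\<rbrakk> \<Longrightarrow> x \<prec> y \<or> x = y \<or> y \<prec> x"
    and add_mono: "\<lbrakk>x \<in> carrier R; y \<in> carrier R; z \<in> carrier R; x \<prec> y\<rbrakk> \<Longrightarrow> x \<oplus> z \<prec> y \<oplus> z"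
    and mult_pos: "\<lbrakk>x \<in> carrier R; y \<in> carrier R; \<zero> \<prec> x; \<zero> \<prec> y\<rbrakk> \<Longrightarrow> \<zero> \<prec> x \<otimes> y"

definition ordered_field_embedding ::
  "('a, 'm) ordered_ring_rec_scheme \<Rightarrow> ('b, 'n) ordered_ring_rec_scheme \<Rightarrow> ('a \<Rightarrow> 'b) \<Rightarrow> bool" where
  "ordered_field_embedding R S h \<longleftrightarrow>
     ordered_field R \<and> ordered_field S \<and>
     h \<in> ring_hom R S \<and> inj_on h (carrier R) \<and>
     (\<forall>x\<in>carrier R. \<forall>y\<in>carrier R. h x \<prec>\<^bsub>S\<^esub> h y \<longleftrightarrow> x \<prec>\<^bsub>R\<^esub> y)"

definition ordered_field_iso ::
  "('a, 'm) ordered_ring_rec_scheme \<Rightarrow> ('b, 'n) ordered_ring_rec_scheme \<Rightarrow> ('a \<Rightarrow> 'b) \<Rightarrow> bool" where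
  "ordered_field_iso R S h \<longleftrightarrow>
     ordered_field R \<and> ordered_field S \<and>
     h \<in> ring_iso R S \<and>
     (\<forall>x\<in>carrier R. \<forall>y\<in>carrier R. h x \<prec>\<^bsub>S\<^esub> h y \<longleftrightarrow> x \<prec>\<^bsub>R\<^esub> y)"

definition real_ordered_field :: "real ordered_ring_rec" where
  "real_ordered_field =
     \<lparr>carrier = UNIV, mult = (*), one = 1, zero = 0, add = (+), lt = (<)\<rparr>"

text \<open>The operation induced by \<open>f\<close> on equivalence classes of \<open>r\<close>. When \<open>f\<close> respects \<open>r\<close>,
  all the classes in the union coincide, so that the value is again a class.\<close>

definition lift_op :: "('a \<times> 'a) set \<Rightarrow> ('a \<Rightarrow> 'a \<Rightarrow> 'a) \<Rightarrow> 'a set \<Rightarrow> 'a set \<Rightarrow> 'a set" where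
  "lift_op r f X Y = (\<Union>x\<in>X. \<Union>y\<in>Y. r `` {f x y})"

section \<open>Ultrafilters\<close>

text \<open>A set \<open>A\<close> of indices belongs to the ultrafilter iff \<open>\<forall>\<^sub>F n in U. n \<in> A\<close>.
  Principal ultrafilters are allowed.\<close>

definition ultrafilter :: "'a filter \<Rightarrow> bool" where
  "ultrafilter U \<longleftrightarrow> U \<noteq> bot \<and> (\<forall>P. eventually P U \<or> eventually (\<lambda>x. \<not> P x) U)"

section \<open>The Eudoxus reals\<close>

definition almost_homs :: "(int \<Rightarrow> int) set" where
  "almost_homs = {f. bounded (range (\<lambda>(p, q). f (p + q) - f p - f q))}"

definition bounded_funs :: "(int \<Rightarrow> int) set" where
  "bounded_funs = {f. bounded (range f)}"

definition eudoxus_rel :: "((int \<Rightarrow> int) \<times> (int \<Rightarrow> int)) set" where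
  "eudoxus_rel =
     {(f, g). f \<in> almost_homs \<and> g \<in> almost_homs \<and> (\<lambda>a. f a - g a) \<in> bounded_funs}"

definition eudoxus_pos :: "(int \<Rightarrow> int) set \<Rightarrow> bool" where
  "eudoxus_pos X \<longleftrightarrow> (\<exists>f\<in>X. (SUP m::nat. ereal (of_int (f (int m)))) = \<infinity>)"

definition eudoxus_reals :: "(int \<Rightarrow> int) set ordered_ring_rec" where
  "eudoxus_reals =
     \<lparr>carrier = almost_homs // eudoxus_rel,
      mult = lift_op eudoxus_rel (\<lambda>f g. f \<circ> g),
      one = eudoxus_rel `` {\<lambda>a. a},
      zero = eudoxus_rel `` {\<lambda>a. 0},
      add = lift_op eudoxus_rel (\<lambda>f g a. f a + g a),
      lt = (\<lambda>X Y. eudoxus_pos (lift_op eudoxus_rel (\<lambda>g f a. g a - f a) Y X))\<rparr>"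

section \<open>The Eudoxus hyperreals\<close>

text \<open>The integer \<open>u\<^sup>a\<^sub>n\<close> is written \<open>u n a\<close>.\<close>

definition almost_hom_families :: "(nat \<Rightarrow> int \<Rightarrow> int) set" where
  "almost_hom_families = {u. \<forall>n. u n \<in> almost_homs}"

definition eudoxus_hyper_rel ::
  "nat filter \<Rightarrow> ((nat \<Rightarrow> int \<Rightarrow> int) \<times> (nat \<Rightarrow> int \<Rightarrow> int)) set" where
  "eudoxus_hyper_rel U =
     {(u, v). u \<in> almost_hom_families \<and> v \<in> almost_hom_families \<and>
              (\<forall>\<^sub>F n in U. (u n, v n) \<in> eudoxus_rel)}"

definition eudoxus_hyperreals :: "nat filter \<Rightarrow> (nat \<Rightarrow> int \<Rightarrow> int) set ordered_ring_rec" where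
  "eudoxus_hyperreals U =
     \<lparr>carrier = almost_hom_families // eudoxus_hyper_rel U,
      mult = lift_op (eudoxus_hyper_rel U) (\<lambda>u v n. u n \<circ> v n),
      one = eudoxus_hyper_rel U `` {\<lambda>n a. a},
      zero = eudoxus_hyper_rel U `` {\<lambda>n a. 0},
      add = lift_op (eudoxus_hyper_rel U) (\<lambda>u v n a. u n a + v n a),
      lt = (\<lambda>X Y. \<exists>u\<in>X. \<exists>v\<in>Y. \<forall>\<^sub>F n in U.
              eudoxus_rel `` {u n} \<prec>\<^bsub>eudoxus_reals\<^esub> eudoxus_rel `` {v n})\<rparr>"

section \<open>The ultrapower of the reals\<close>

definition real_ultrapower_rel :: "nat filter \<Rightarrow> ((nat \<Rightarrow> real) \<times> (nat \<Rightarrow> real)) set" where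
  "real_ultrapower_rel U = {(x, y). \<forall>\<^sub>F n in U. x n = y n}"

definition real_ultrapower :: "nat filter \<Rightarrow> (nat \<Rightarrow> real) set ordered_ring_rec" where
  "real_ultrapower U =
     \<lparr>carrier = UNIV // real_ultrapower_rel U,
      mult = lift_op (real_ultrapower_rel U) (\<lambda>x y n. x n * y n),
      one = real_ultrapower_rel U `` {\<lambda>n. 1},
      zero = real_ultrapower_rel U `` {\<lambda>n. 0},
      add = lift_op (real_ultrapower_rel U) (\<lambda>x y n. x n + y n),
      lt = (\<lambda>X Y. \<exists>x\<in>X. \<exists>y\<in>Y. \<forall>\<^sub>F n in U. x n < y n)\<rparr>"

end

theory Submission
  imports Defs
begin

text \<open>
  An almost homomorphism \<open>f\<close> stays within bounded distance of exactly one linear function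
  \<open>a \<mapsto> r * a\<close>, and conversely every function close to a linear one is an almost homomorphism.
  The slope \<open>r\<close> is a complete invariant of the class of \<open>f\<close> in the Eudoxus reals: addition of
  almost homomorphisms adds slopes, composition multiplies them, and the class is positive iff the
  slope is. The function \<open>a \<mapsto> \<lfloor>r * a\<rfloor>\<close> has slope \<open>r\<close>, so every real number occurs.

  Applied at each index, this shows that sending a real sequence \<open>x\<close> to the class of
  \<open>(a, n) \<mapsto> \<lfloor>x n * a\<rfloor>\<close> maps onto the Eudoxus hyperreals, identifies two sequences iff
  they agree on a set of the ultrafilter, and turns the pointwise operations and order of sequences
  into those of the hyperreals. The quotient map onto the ultrapower has literally the same
  properties. These properties, collected in the locale \<open>real_ultrapower_model\<close>, determine the
  structure up to isomorphism (\<open>real_ultrapower_models_iso\<close>), they force it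
  to be an ordered field (\<open>is_ordered_field\<close>), and they make the constant sequences a copy of
  the ordered field of real numbers (\<open>constant_embedding\<close>). For the hyperreals, the class
  of a constant sequence \<open>r\<close> is the class of \<open>\<lfloor>r * a\<rfloor>\<close>, which is the inclusion in question.
\<close>

section \<open>Models of the ultrapower of the reals\<close>

text \<open>
  A structure presented by real sequences, with the pointwise operations, in which equality and order
  mean equality and order at almost every index. Working with such a presentation rather than
  with equivalence classes lets the ordered field laws be read off from those of \<open>\<real>\<close> once, for
  both structures to be compared.
\<close>

locale real_ultrapower_model =
  fixes U :: "nat filter"
    and S :: "('s, 'm) ordered_ring_rec_scheme" (structure)
    and cls :: "(nat \<Rightarrow> real) \<Rightarrow> 's"
  assumes ultrafilter: "ultrafilter U"
    and carrier_eq: "carrier S = range cls"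
    and cls_eq_iff: "cls x = cls y \<longleftrightarrow> (\<forall>\<^sub>F n in U. x n = y n)"
    and cls_add: "cls x \<oplus> cls y = cls (\<lambda>n. x n + y n)"
    and cls_mult: "cls x \<otimes> cls y = cls (\<lambda>n. x n * y n)"
    and cls_zero: "\<zero> = cls (\<lambda>n. 0)"
    and cls_one: "\<one> = cls (\<lambda>n. 1)"
    and cls_less_iff: "cls x \<prec>\<^bsub>S\<^esub> cls y \<longleftrightarrow> (\<forall>\<^sub>F n in U. x n < y n)"
begin

lemma proper: "U \<noteq> bot"
  using ultrafilter by (simp add: ultrafilter_def)

lemma eventually_or_not: "(\<forall>\<^sub>F n in U. P n) \<or> (\<forall>\<^sub>F n in U. \<not> P n)"
  using ultrafilter by (simp add: ultrafilter_def)

lemma cls_in_carrier [simp]: "cls x \<in> carrier S"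
  by (simp add: carrier_eq)

lemma carrier_cases:
  assumes "X \<in> carrier S"
  obtains x where "X = cls x"
  using assms by (auto simp: carrier_eq)

lemma is_cring: "cring S"
proof (rule cringI)
  show "abelian_group S"
  proof (rule abelian_groupI)
    fix X assume "X \<in> carrier S"
    then obtain x where X: "X = cls x" by (rule carrier_cases)
    have "cls (\<lambda>n. - x n) \<oplus> X = \<zero>"
      by (simp add: X cls_add cls_zero)
    then show "\<exists>Y\<in>carrier S. Y \<oplus> X = \<zero>"
      by (rule bexI) simp
  qed (auto simp: carrier_eq cls_add cls_zero algebra_simps)
  show "comm_monoid S"
    by (rule comm_monoidI) (auto simp: carrier_eq cls_mult cls_one algebra_simps)
qed (auto simp: carrier_eq cls_add cls_mult algebra_simps)

text \<open>
  The pointwise inverse works because an ultrafilter contains either the set of zeros of a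
  sequence or its complement, so that a nonzero class is nonzero at almost every index.
\<close>

lemma is_field: "field S"
proof -
  interpret cring S by (rule is_cring)
  have "\<zero> \<noteq> \<one>"
    using proper by (simp add: cls_zero cls_one cls_eq_iff)
  moreover have "X \<in> Units S" if X_in: "X \<in> carrier S" and X_nz: "X \<noteq> \<zero>" for X
  proof -
    obtain x where X: "X = cls x" using X_in by (rule carrier_cases)
    have "\<forall>\<^sub>F n in U. x n \<noteq> 0"
      using X_nz eventually_or_not[of "\<lambda>n. x n = 0"] by (simp add: X cls_zero cls_eq_iff)
    then have "\<forall>\<^sub>F n in U. x n * inverse (x n) = 1"
      by eventually_elim simp
    then have "X \<otimes> cls (\<lambda>n. inverse (x n)) = \<one>"
      by (simp add: X cls_mult cls_one cls_eq_iff)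
    then show ?thesis
      using X_in m_comm[of X "cls (\<lambda>n. inverse (x n))"] by (auto simp: Units_def)
  qed
  moreover have "\<zero> \<notin> Units S"
    using \<open>\<zero> \<noteq> \<one>\<close> by (auto simp: Units_def)
  ultimately have "Units S = carrier S - {\<zero>}"
    by (auto simp: Units_def)
  then show ?thesis by (rule cring_fieldI)
qed

lemma is_ordered_field: "ordered_field S"
proof -
  interpret field S by (rule is_field)
  show ?thesis
  proof
    fix X assume "X \<in> carrier S"
    then show "\<not> X \<prec>\<^bsub>S\<^esub> X"
      using proper by (auto simp: carrier_eq cls_less_iff)
  next
    fix X Y Z assume less: "X \<prec>\<^bsub>S\<^esub> Y" "Y \<prec>\<^bsub>S\<^esub> Z"
      and "X \<in> carrier S" "Y \<in> carrier S" "Z \<in> carrier S"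
    then obtain x y z where XYZ: "X = cls x" "Y = cls y" "Z = cls z" by (auto simp: carrier_eq)
    with less have "\<forall>\<^sub>F n in U. x n < y n" "\<forall>\<^sub>F n in U. y n < z n"
      by (simp_all add: cls_less_iff)
    then have "\<forall>\<^sub>F n in U. x n < z n"
      by eventually_elim simp
    then show "X \<prec>\<^bsub>S\<^esub> Z"
      by (simp add: XYZ cls_less_iff)
  next
    fix X Y assume "X \<in> carrier S" "Y \<in> carrier S"
    then obtain x y where XY: "X = cls x" "Y = cls y" by (auto simp: carrier_eq)
    \<comment> \<open>An ultrafilter decides each of the comparisons; if two of them fail almost everywhere, the
      third holds almost everywhere.\<close>
    consider "\<forall>\<^sub>F n in U. x n < y n" | "\<forall>\<^sub>F n in U. y n < x n"
      | "\<forall>\<^sub>F n in U. \<not> x n < y n" "\<forall>\<^sub>F n in U. \<not> y n < x n"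
      using eventually_or_not by blast
    then show "X \<prec>\<^bsub>S\<^esub> Y \<or> X = Y \<or> Y \<prec>\<^bsub>S\<^esub> X"
    proof cases
      case 3
      then have "\<forall>\<^sub>F n in U. x n = y n"
        by eventually_elim simp
      then show ?thesis by (simp add: XY cls_eq_iff)
    qed (simp_all add: XY cls_less_iff)
  next
    fix X Y Z assume "X \<in> carrier S" "Y \<in> carrier S" "Z \<in> carrier S" "X \<prec>\<^bsub>S\<^esub> Y"
    then show "X \<oplus> Z \<prec>\<^bsub>S\<^esub> Y \<oplus> Z"
      by (auto simp: carrier_eq cls_less_iff cls_add)
  next
    fix X Y assume less: "\<zero> \<prec>\<^bsub>S\<^esub> X" "\<zero> \<prec>\<^bsub>S\<^esub> Y"
      and "X \<in> carrier S" "Y \<in> carrier S"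
    then obtain x y where XY: "X = cls x" "Y = cls y" by (auto simp: carrier_eq)
    with less have "\<forall>\<^sub>F n in U. 0 < x n" "\<forall>\<^sub>F n in U. 0 < y n"
      by (simp_all add: cls_zero cls_less_iff)
    then have "\<forall>\<^sub>F n in U. 0 < x n * y n"
      by eventually_elim simp
    then show "\<zero> \<prec>\<^bsub>S\<^esub> X \<otimes> Y"
      by (simp add: XY cls_zero cls_mult cls_less_iff)
  qed
qed

end

lemma ordered_field_real: "ordered_field real_ordered_field"
proof -
  have "cring real_ordered_field"
  proof (rule cringI)
    show "abelian_group real_ordered_field"
      by (rule abelian_groupI) (auto simp: real_ordered_field_def intro: exI[of _ "- x" for x])
    show "comm_monoid real_ordered_field"
      by (rule comm_monoidI) (auto simp: real_ordered_field_def)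
  qed (auto simp: real_ordered_field_def algebra_simps)
  moreover have "\<exists>y. y * x = 1 \<and> x * y = 1" if "x \<noteq> 0" for x :: real
    using that by (intro exI[of _ "inverse x"]) simp
  then have "Units real_ordered_field = carrier real_ordered_field - {\<zero>\<^bsub>real_ordered_field\<^esub>}"
    by (auto simp: Units_def real_ordered_field_def)
  ultimately have "field real_ordered_field"
    by (rule cring.cring_fieldI)
  then show ?thesis
    by (auto simp: ordered_field_def ordered_field_axioms_def real_ordered_field_def)
qed

context real_ultrapower_model
begin

text \<open>Two constant sequences are related at almost every index iff the constants are related,
  because the filter is proper.\<close>

lemma constant_embedding:
  "ordered_field_embedding real_ordered_field S (\<lambda>r. cls (\<lambda>n. r))"
  unfolding ordered_field_embedding_def
  using ordered_field_real is_ordered_field proper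
  by (auto simp: real_ordered_field_def cls_add cls_mult cls_one cls_eq_iff cls_less_iff
      intro!: ring_hom_memI inj_onI)

end

text \<open>Matching the classes of the same sequence is well defined and injective because both
  presentations identify exactly the same sequences.\<close>

lemma real_ultrapower_models_iso:
  assumes "real_ultrapower_model U S cls" and "real_ultrapower_model U T cls'"
  shows "\<exists>\<phi>. ordered_field_iso S T \<phi>"
proof
  interpret S: real_ultrapower_model U S cls by (rule assms)
  interpret T: real_ultrapower_model U T cls' by (rule assms)
  define \<phi> where "\<phi> X = cls' (SOME x. cls x = X)" for X
  have \<phi>: "\<phi> (cls x) = cls' x" for x
  proof -
    have "cls (SOME y. cls y = cls x) = cls x"
      by (rule someI[where P = "\<lambda>y. cls y = cls x"]) simp
    then show ?thesis
      by (simp add: \<phi>_def S.cls_eq_iff T.cls_eq_iff)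
  qed
  have "\<phi> \<in> ring_hom S T"
    by (rule ring_hom_memI)
      (auto simp: S.carrier_eq \<phi> S.cls_add S.cls_mult S.cls_one T.cls_add T.cls_mult T.cls_one)
  moreover have "bij_betw \<phi> (carrier S) (carrier T)"
    by (auto simp: bij_betw_def inj_on_def S.carrier_eq T.carrier_eq \<phi> S.cls_eq_iff T.cls_eq_iff
        image_image)
  ultimately show "ordered_field_iso S T \<phi>"
    unfolding ordered_field_iso_def ring_iso_def
    using S.is_ordered_field T.is_ordered_field
    by (auto simp: S.carrier_eq \<phi> S.cls_less_iff T.cls_less_iff)
qed

text \<open>On classes of a congruence, all the sets in the union defining \<open>lift_op\<close> coincide, so that
  it computes the induced operation.\<close>

lemma lift_op_class:
  assumes "equiv A r" and "a \<in> A" and "b \<in> A"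
    and "\<And>x x' y y'. (x, x') \<in> r \<Longrightarrow> (y, y') \<in> r \<Longrightarrow> (f x y, f x' y') \<in> r"
  shows "lift_op r f (r `` {a}) (r `` {b}) = r `` {f a b}"
proof -
  have "congruent2 r r (\<lambda>x y. r `` {f x y})"
    using assms(1,4) by (auto simp: congruent2_def intro!: equiv_class_eq)
  then show ?thesis
    unfolding lift_op_def using assms(1-3) by (intro UN_equiv_class2)
qed

lemma real_ultrapower_is_model:
  assumes "ultrafilter U"
  shows "real_ultrapower_model U (real_ultrapower U) (\<lambda>x. real_ultrapower_rel U `` {x})"
proof -
  let ?r = "real_ultrapower_rel U"
  have equiv: "equiv UNIV ?r"
  proof (rule equivI)
    show "refl ?r" by (simp add: refl_on_def real_ultrapower_rel_def)
    show "sym ?r" by (simp add: sym_def real_ultrapower_rel_def eq_commute)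
    show "trans ?r"
      by (auto simp: trans_def real_ultrapower_rel_def elim: eventually_elim2)
  qed simp
  show ?thesis
  proof
    fix x y
    show "?r `` {x} \<oplus>\<^bsub>real_ultrapower U\<^esub> ?r `` {y} = ?r `` {\<lambda>n. x n + y n}"
      by (auto simp: real_ultrapower_def real_ultrapower_rel_def elim: eventually_elim2
          intro!: lift_op_class[OF equiv[unfolded real_ultrapower_rel_def], simplified])
    show "?r `` {x} \<otimes>\<^bsub>real_ultrapower U\<^esub> ?r `` {y} = ?r `` {\<lambda>n. x n * y n}"
      by (auto simp: real_ultrapower_def real_ultrapower_rel_def elim: eventually_elim2
          intro!: lift_op_class[OF equiv[unfolded real_ultrapower_rel_def], simplified])
    have "\<forall>\<^sub>F n in U. x n < y n"
      if "x' \<in> ?r `` {x}" "y' \<in> ?r `` {y}" "\<forall>\<^sub>F n in U. x' n < y' n" for x' y'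
    proof -
      have "\<forall>\<^sub>F n in U. x n = x' n" "\<forall>\<^sub>F n in U. y n = y' n"
        using that(1,2) by (simp_all add: real_ultrapower_rel_def)
      with that(3) show ?thesis by eventually_elim simp
    qed
    moreover have "x \<in> ?r `` {x}" "y \<in> ?r `` {y}"
      by (simp_all add: real_ultrapower_rel_def)
    ultimately show "?r `` {x} \<prec>\<^bsub>real_ultrapower U\<^esub> ?r `` {y} \<longleftrightarrow> (\<forall>\<^sub>F n in U. x n < y n)"
      unfolding real_ultrapower_def ordered_ring_rec.simps by blast
    show "?r `` {x} = ?r `` {y} \<longleftrightarrow> (\<forall>\<^sub>F n in U. x n = y n)"
      using eq_equiv_class_iff[OF equiv] by (simp add: real_ultrapower_rel_def)
  next
    show "carrier (real_ultrapower U) = range (\<lambda>x. ?r `` {x})"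
      unfolding real_ultrapower_def partial_object.simps quotient_def by blast
  qed (simp_all add: assms real_ultrapower_def)
qed

section \<open>Slopes of almost homomorphisms\<close>

definition has_slope :: "(int \<Rightarrow> int) \<Rightarrow> real \<Rightarrow> bool" where
  "has_slope f r \<longleftrightarrow> (\<exists>C. \<forall>a. \<bar>of_int (f a) - r * of_int a\<bar> \<le> C)"

lemma bounded_real_iff:
  fixes X :: "real set"
  shows "bounded X \<longleftrightarrow> (\<exists>C. \<forall>x\<in>X. \<bar>x\<bar> \<le> C)"
  using bounded_any_center[of X 0] by (simp add: dist_real_def)

lemma almost_homs_iff:
  "f \<in> almost_homs \<longleftrightarrow> (\<exists>C::real. \<forall>p q. \<bar>of_int (f (p + q)) - of_int (f p) - of_int (f q)\<bar> \<le> C)"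
  by (auto simp: almost_homs_def bounded_real_iff)

lemma bounded_funs_iff: "f \<in> bounded_funs \<longleftrightarrow> has_slope f 0"
  by (auto simp: bounded_funs_def bounded_real_iff has_slope_def)

lemma has_slope_floor: "has_slope (\<lambda>a. \<lfloor>r * of_int a\<rfloor>) r"
proof -
  have "\<bar>of_int \<lfloor>r * of_int a\<rfloor> - r * of_int a\<bar> \<le> 1" for a
    by linarith
  then show ?thesis by (auto simp: has_slope_def)
qed

lemma has_slope_add:
  assumes "has_slope f r" and "has_slope g s"
  shows "has_slope (\<lambda>a. f a + g a) (r + s)"
proof -
  obtain C D where C: "\<And>a. \<bar>of_int (f a) - r * of_int a\<bar> \<le> C"
    and D: "\<And>a. \<bar>of_int (g a) - s * of_int a\<bar> \<le> D"
    using assms by (auto simp: has_slope_def)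
  have "\<bar>of_int (f a + g a) - (r + s) * of_int a\<bar> \<le> C + D" for a
    using C[of a] D[of a] unfolding of_int_add distrib_right by linarith
  then show ?thesis by (auto simp: has_slope_def)
qed

lemma has_slope_diff:
  assumes "has_slope f r" and "has_slope g s"
  shows "has_slope (\<lambda>a. f a - g a) (r - s)"
proof -
  have "has_slope (\<lambda>a. - g a) (- s)"
    using assms(2) by (simp add: has_slope_def abs_minus_commute)
  from has_slope_add[OF assms(1) this] show ?thesis by simp
qed

lemma has_slope_comp:
  assumes "has_slope f r" and "has_slope g s"
  shows "has_slope (f \<circ> g) (r * s)"
proof -
  obtain C D where C: "\<And>a. \<bar>of_int (f a) - r * of_int a\<bar> \<le> C"
    and D: "\<And>a. \<bar>of_int (g a) - s * of_int a\<bar> \<le> D"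
    using assms by (auto simp: has_slope_def)
  have "\<bar>of_int ((f \<circ> g) a) - r * s * of_int a\<bar> \<le> C + \<bar>r\<bar> * D" for a
  proof -
    have "of_int ((f \<circ> g) a) - r * s * of_int a
        = (of_int (f (g a)) - r * of_int (g a)) + r * (of_int (g a) - s * of_int a)"
      by (simp add: algebra_simps)
    also have "\<bar>\<dots>\<bar> \<le> \<bar>of_int (f (g a)) - r * of_int (g a)\<bar> + \<bar>r * (of_int (g a) - s * of_int a)\<bar>"
      by (rule abs_triangle_ineq)
    also have "\<dots> \<le> C + \<bar>r\<bar> * D"
      unfolding abs_mult by (intro add_mono C mult_left_mono D) simp
    finally show ?thesis .
  qed
  then show ?thesis by (auto simp: has_slope_def)
qed

text \<open>A nonconstant linear function escapes every bound, by the Archimedean property. Both the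
  uniqueness of slopes and the description of positivity depend on this.\<close>

lemma has_slope_pos_unbounded:
  fixes B :: real
  assumes "has_slope f r" and "r > 0"
  shows "\<exists>m::nat. B \<le> of_int (f (int m))"
proof -
  obtain C where C: "\<And>a. \<bar>of_int (f a) - r * of_int a\<bar> \<le> C"
    using assms(1) by (auto simp: has_slope_def)
  obtain m :: nat where "(B + C) / r \<le> of_nat m"
    using real_arch_simple by blast
  then have "B + C \<le> r * of_int (int m)"
    using assms(2) by (simp add: field_simps)
  then show ?thesis
    using C[of "int m"] by (intro exI[of _ m]) linarith
qed

lemma has_slope_nonpos_bounded_above:
  assumes "has_slope f r" and "r \<le> 0"
  obtains C :: real where "\<And>m::nat. of_int (f (int m)) \<le> C"
proof -
  obtain C where C: "\<And>a. \<bar>of_int (f a) - r * of_int a\<bar> \<le> C"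
    using assms(1) by (auto simp: has_slope_def)
  have "of_int (f (int m)) \<le> C" for m :: nat
    using C[of "int m"] mult_nonpos_nonneg[OF assms(2), of "of_int (int m)"] by simp
  then show ?thesis by (rule that)
qed

lemma has_slope_unique:
  assumes "has_slope f r" and "has_slope f s"
  shows "r = s"
proof -
  have "\<not> r < s" if "has_slope f r" "has_slope f s" for r s
  proof
    assume "r < s"
    \<comment> \<open>The zero function, as \<open>f - f\<close>, would have positive slope.\<close>
    have "has_slope (\<lambda>a. 0) (s - r)"
      using has_slope_diff[OF that(2,1)] by simp
    then show False
      using has_slope_pos_unbounded[of "\<lambda>a. 0" "s - r" 1] \<open>r < s\<close> by simp
  qed
  from this[OF assms] this[OF assms(2,1)] show ?thesis by linarith
qed

lemma has_slope_imp_almost_hom: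
  assumes "has_slope f r"
  shows "f \<in> almost_homs"
proof -
  obtain C where C: "\<And>a. \<bar>of_int (f a) - r * of_int a\<bar> \<le> C"
    using assms by (auto simp: has_slope_def)
  have "\<bar>of_int (f (p + q)) - of_int (f p) - of_int (f q)\<bar> \<le> 3 * C" for p q
  proof -
    have "r * of_int (p + q) = r * of_int p + r * of_int q"
      by (simp add: distrib_left)
    then show ?thesis
      using C[of "p + q"] C[of p] C[of q] unfolding abs_le_iff by linarith
  qed
  then show ?thesis by (auto simp: almost_homs_iff)
qed

text \<open>
  The slope is the limit of \<open>f m / m\<close>. Additivity up to \<open>C\<close>, iterated, compares \<open>f (k * m)\<close>
  both with \<open>k * f m\<close> and with \<open>m * f k\<close>, so that the quotients at \<open>m\<close> and \<open>k\<close> differ by at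
  most \<open>C / m + C / k\<close>. Thus they form a Cauchy sequence, and letting \<open>k\<close> tend to
  infinity bounds the distance of \<open>f m\<close> from \<open>r * m\<close> by the same constant \<open>C\<close> for all \<open>m\<close>.
\<close>

lemma almost_hom_has_slope:
  assumes "f \<in> almost_homs"
  shows "\<exists>r. has_slope f r"
proof -
  obtain C :: real where C: "\<And>p q. \<bar>of_int (f (p + q)) - of_int (f p) - of_int (f q)\<bar> \<le> C"
    using assms by (auto simp: almost_homs_iff)
  have C0: "C \<ge> 0" using C[of 0 0] by linarith
  have mult: "\<bar>of_int (f (int (Suc k) * a)) - of_nat (Suc k) * of_int (f a)\<bar> \<le> of_nat (Suc k) * C"
    for k a
  proof (induction k)
    case 0
    then show ?case using C0 by simp
  next
    case (Suc k)
    have "int (Suc (Suc k)) * a = int (Suc k) * a + a"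
      by (simp add: algebra_simps)
    then show ?case
      using Suc C[of "int (Suc k) * a" a] by (simp add: distrib_right abs_le_iff)
  qed
  define q where "q k = of_int (f (int (Suc k))) / real (Suc k)" for k
  have close: "\<bar>q m - q k\<bar> \<le> C / real (Suc m) + C / real (Suc k)" for m k
  proof -
    let ?m = "real (Suc m)" and ?k = "real (Suc k)"
    have "\<bar>?k * of_int (f (int (Suc m))) - ?m * of_int (f (int (Suc k)))\<bar> \<le> ?k * C + ?m * C"
      using mult[of k "int (Suc m)"] mult[of m "int (Suc k)"]
      by (simp only: mult.commute[of "int (Suc m)"] abs_le_iff) linarith
    moreover have "q m - q k
        = (?k * of_int (f (int (Suc m))) - ?m * of_int (f (int (Suc k)))) / (?m * ?k)"
      by (simp add: q_def field_simps del: of_nat_Suc)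
    ultimately have "\<bar>q m - q k\<bar> \<le> (?k * C + ?m * C) / (?m * ?k)"
      by (simp add: abs_mult divide_right_mono del: of_nat_Suc)
    also have "\<dots> = C / ?m + C / ?k"
      by (simp add: field_simps del: of_nat_Suc)
    finally show ?thesis .
  qed
  have lim0: "(\<lambda>k. C / real (Suc k)) \<longlonglongrightarrow> 0"
    using tendsto_mult[OF tendsto_const[of C] LIMSEQ_inverse_real_of_nat]
    by (simp add: divide_inverse)
  have "Cauchy q"
  proof (rule metric_CauchyI)
    fix e :: real assume "e > 0"
    then have "\<forall>\<^sub>F k in sequentially. C / real (Suc k) < e / 2"
      using order_tendstoD(2)[OF lim0, of "e / 2"] by simp
    then obtain N where N: "\<And>k. k \<ge> N \<Longrightarrow> C / real (Suc k) < e / 2"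
      by (auto simp: eventually_sequentially)
    have "dist (q m) (q k) < e" if "m \<ge> N" "k \<ge> N" for m k
      using close[of m k] N[OF that(1)] N[OF that(2)] unfolding dist_real_def by linarith
    then show "\<exists>N. \<forall>m\<ge>N. \<forall>k\<ge>N. dist (q m) (q k) < e" by blast
  qed
  then obtain r where r: "q \<longlonglongrightarrow> r"
    using Cauchy_convergent convergent_def by blast
  have pos: "\<bar>of_int (f (int (Suc m))) - r * real (Suc m)\<bar> \<le> C" for m
  proof -
    have "\<bar>q m - r\<bar> \<le> C / real (Suc m) + 0"
    proof (rule tendsto_le[OF sequentially_bot])
      show "(\<lambda>k. \<bar>q m - q k\<bar>) \<longlonglongrightarrow> \<bar>q m - r\<bar>"
        by (intro tendsto_intros r)
      show "(\<lambda>k. C / real (Suc m) + C / real (Suc k)) \<longlonglongrightarrow> C / real (Suc m) + 0"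
        by (intro tendsto_add tendsto_const lim0)
    qed (simp add: close del: of_nat_Suc)
    then have "\<bar>q m - r\<bar> * real (Suc m) \<le> C"
      by (simp add: pos_le_divide_eq del: of_nat_Suc)
    moreover have "of_int (f (int (Suc m))) - r * real (Suc m) = (q m - r) * real (Suc m)"
      by (simp add: q_def field_simps del: of_nat_Suc)
    ultimately show ?thesis
      by (simp add: abs_mult del: of_nat_Suc)
  qed
  \<comment> \<open>\<open>f (- m)\<close> differs from \<open>- f m\<close> by at most \<open>C + \<bar>f 0\<bar> \<le> 2 * C\<close>.\<close>
  have "\<bar>of_int (f a) - r * of_int a\<bar> \<le> 3 * C" for a
  proof -
    have zero: "\<bar>of_int (f 0)\<bar> \<le> C" using C[of 0 0] by simp
    consider "a = 0" | m where "a = int (Suc m)" | m where "a = - int (Suc m)"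
      by (cases a rule: int_cases3) (metis Suc_pred)+
    then show ?thesis
    proof cases
      case 1
      then show ?thesis using zero C0 by simp
    next
      case (2 m)
      then show ?thesis using pos[of m] C0 by simp
    next
      case (3 m)
      have "\<bar>of_int (f 0) - of_int (f a) - of_int (f (int (Suc m)))\<bar> \<le> C"
        using C[of a "int (Suc m)"] by (simp add: 3)
      moreover have "r * of_int a = - (r * real (Suc m))"
        by (simp add: 3 algebra_simps)
      ultimately show ?thesis
        using pos[of m] zero by linarith
    qed
  qed
  then show ?thesis by (auto simp: has_slope_def)
qed

definition slope :: "(int \<Rightarrow> int) \<Rightarrow> real" where
  "slope f = (THE r. has_slope f r)"

lemma slope_eq: "has_slope f r \<Longrightarrow> slope f = r"
  using has_slope_unique by (auto simp: slope_def)

lemma has_slope_slope: "f \<in> almost_homs \<Longrightarrow> has_slope f (slope f)"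
  using almost_hom_has_slope slope_eq by metis

lemma almost_homs_floor [simp]: "(\<lambda>a. \<lfloor>(r::real) * of_int a\<rfloor>) \<in> almost_homs"
  by (rule has_slope_imp_almost_hom[OF has_slope_floor])

lemma slope_floor [simp]: "slope (\<lambda>a. \<lfloor>r * of_int a\<rfloor>) = r"
  by (rule slope_eq[OF has_slope_floor])

lemma
  assumes "f \<in> almost_homs" and "g \<in> almost_homs"
  shows almost_homs_add: "(\<lambda>a. f a + g a) \<in> almost_homs"
    and slope_add: "slope (\<lambda>a. f a + g a) = slope f + slope g"
    and almost_homs_diff: "(\<lambda>a. f a - g a) \<in> almost_homs"
    and slope_diff: "slope (\<lambda>a. f a - g a) = slope f - slope g"
    and almost_homs_comp: "f \<circ> g \<in> almost_homs"
    and slope_comp: "slope (f \<circ> g) = slope f * slope g"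
proof -
  note fg = assms[THEN has_slope_slope]
  note add = has_slope_add[OF fg] and diff = has_slope_diff[OF fg] and comp = has_slope_comp[OF fg]
  show "(\<lambda>a. f a + g a) \<in> almost_homs" "slope (\<lambda>a. f a + g a) = slope f + slope g"
    by (rule has_slope_imp_almost_hom[OF add] slope_eq[OF add])+
  show "(\<lambda>a. f a - g a) \<in> almost_homs" "slope (\<lambda>a. f a - g a) = slope f - slope g"
    by (rule has_slope_imp_almost_hom[OF diff] slope_eq[OF diff])+
  show "f \<circ> g \<in> almost_homs" "slope (f \<circ> g) = slope f * slope g"
    by (rule has_slope_imp_almost_hom[OF comp] slope_eq[OF comp])+
qed

section \<open>The order of the Eudoxus reals in terms of slopes\<close>

lemma eudoxus_rel_iff:
  "(f, g) \<in> eudoxus_rel \<longleftrightarrow> f \<in> almost_homs \<and> g \<in> almost_homs \<and> slope f = slope g"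
proof -
  have "has_slope (\<lambda>a. f a - g a) 0 \<longleftrightarrow> slope f = slope g"
    if "f \<in> almost_homs" "g \<in> almost_homs"
    using has_slope_slope[OF almost_homs_diff[OF that]] slope_diff[OF that]
      slope_eq[of "\<lambda>a. f a - g a" 0] by auto
  then show ?thesis
    by (auto simp: eudoxus_rel_def bounded_funs_iff)
qed

lemma equiv_eudoxus_rel: "equiv almost_homs eudoxus_rel"
  by (rule equivI) (auto simp: refl_on_def sym_def trans_def eudoxus_rel_iff)

lemma sup_infinite_iff_slope_pos:
  assumes "f \<in> almost_homs"
  shows "(SUP m::nat. ereal (of_int (f (int m)))) = \<infinity> \<longleftrightarrow> slope f > 0"
proof
  assume inf: "(SUP m::nat. ereal (of_int (f (int m)))) = \<infinity>"
  show "slope f > 0"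
  proof (rule ccontr)
    assume "\<not> slope f > 0"
    then obtain C :: real where "\<And>m::nat. of_int (f (int m)) \<le> C"
      using has_slope_nonpos_bounded_above[OF has_slope_slope[OF assms]] by (metis not_less)
    then have "(SUP m::nat. ereal (of_int (f (int m)))) \<le> ereal C"
      by (intro SUP_least) simp
    with inf show False by simp
  qed
next
  assume "slope f > 0"
  then show "(SUP m::nat. ereal (of_int (f (int m)))) = \<infinity>"
    using has_slope_pos_unbounded[OF has_slope_slope[OF assms]] by (intro SUP_PInfty) simp
qed

lemma eudoxus_pos_iff:
  assumes "f \<in> almost_homs"
  shows "eudoxus_pos (eudoxus_rel `` {f}) \<longleftrightarrow> slope f > 0"
  using assms by (auto simp: eudoxus_pos_def eudoxus_rel_iff sup_infinite_iff_slope_pos)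

lemma eudoxus_less_iff:
  assumes "f \<in> almost_homs" and "g \<in> almost_homs"
  shows "eudoxus_rel `` {f} \<prec>\<^bsub>eudoxus_reals\<^esub> eudoxus_rel `` {g} \<longleftrightarrow> slope f < slope g"
proof -
  have "lift_op eudoxus_rel (\<lambda>g f a. g a - f a) (eudoxus_rel `` {g}) (eudoxus_rel `` {f})
      = eudoxus_rel `` {\<lambda>a. g a - f a}"
    using assms
    by (intro lift_op_class[OF equiv_eudoxus_rel])
      (auto simp: eudoxus_rel_iff almost_homs_diff slope_diff)
  then show ?thesis
    using assms by (simp add: eudoxus_reals_def eudoxus_pos_iff almost_homs_diff slope_diff)
qed

section \<open>The Eudoxus hyperreals as a model of the ultrapower\<close>

lemma eudoxus_hyper_rel_iff:
  "(u, v) \<in> eudoxus_hyper_rel U \<longleftrightarrow>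
     u \<in> almost_hom_families \<and> v \<in> almost_hom_families \<and> (\<forall>\<^sub>F n in U. slope (u n) = slope (v n))"
  by (auto simp: eudoxus_hyper_rel_def eudoxus_rel_iff almost_hom_families_def)

lemma equiv_eudoxus_hyper_rel: "equiv almost_hom_families (eudoxus_hyper_rel U)"
proof (rule equivI)
  show "trans (eudoxus_hyper_rel U)"
    by (rule transI) (auto simp: eudoxus_hyper_rel_iff elim: eventually_elim2)
qed (auto simp: refl_on_def sym_def eudoxus_hyper_rel_iff eq_commute)

lemma eudoxus_hyper_class_eq_iff:
  assumes "u \<in> almost_hom_families" and "v \<in> almost_hom_families"
  shows "eudoxus_hyper_rel U `` {u} = eudoxus_hyper_rel U `` {v} \<longleftrightarrow>
    (\<forall>\<^sub>F n in U. slope (u n) = slope (v n))"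
  using eq_equiv_class_iff[OF equiv_eudoxus_hyper_rel assms] assms
  by (simp add: eudoxus_hyper_rel_iff)

text \<open>The order of the hyperreals asks for some representatives that compare at almost every index.
  Slopes show that the choice is immaterial: changing representatives preserves almost all of them.\<close>

lemma eudoxus_hyper_less_iff:
  assumes "u \<in> almost_hom_families" and "v \<in> almost_hom_families"
  shows "eudoxus_hyper_rel U `` {u} \<prec>\<^bsub>eudoxus_hyperreals U\<^esub> eudoxus_hyper_rel U `` {v} \<longleftrightarrow>
    (\<forall>\<^sub>F n in U. slope (u n) < slope (v n))"
proof -
  have less: "(\<forall>\<^sub>F n in U. eudoxus_rel `` {u' n} \<prec>\<^bsub>eudoxus_reals\<^esub> eudoxus_rel `` {v' n})
      \<longleftrightarrow> (\<forall>\<^sub>F n in U. slope (u n) < slope (v n))"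
    if "u' \<in> eudoxus_hyper_rel U `` {u}" "v' \<in> eudoxus_hyper_rel U `` {v}" for u' v'
  proof (rule eventually_cong)
    show "\<forall>\<^sub>F n in U. slope (u n) = slope (u' n) \<and> slope (v n) = slope (v' n)"
      using that by (simp add: eudoxus_hyper_rel_iff eventually_conj_iff)
    fix n assume "slope (u n) = slope (u' n) \<and> slope (v n) = slope (v' n)"
    moreover have "u' n \<in> almost_homs" "v' n \<in> almost_homs"
      using that by (simp_all add: eudoxus_hyper_rel_iff almost_hom_families_def)
    ultimately show "eudoxus_rel `` {u' n} \<prec>\<^bsub>eudoxus_reals\<^esub> eudoxus_rel `` {v' n}
        \<longleftrightarrow> slope (u n) < slope (v n)"
      by (simp add: eudoxus_less_iff)
  qed
  moreover have "u \<in> eudoxus_hyper_rel U `` {u}" "v \<in> eudoxus_hyper_rel U `` {v}"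
    using assms by (simp_all add: eudoxus_hyper_rel_iff)
  ultimately show ?thesis
    unfolding eudoxus_hyperreals_def ordered_ring_rec.simps by blast
qed

definition floor_family :: "(nat \<Rightarrow> real) \<Rightarrow> nat \<Rightarrow> int \<Rightarrow> int" where
  "floor_family x n a = \<lfloor>x n * of_int a\<rfloor>"

lemma floor_family_in [simp]: "floor_family x \<in> almost_hom_families"
  by (simp add: almost_hom_families_def floor_family_def[abs_def])

lemma slope_floor_family [simp]: "slope (floor_family x n) = x n"
  by (simp add: floor_family_def[abs_def])

text \<open>Every family may be replaced by the family of floors with the same slopes. In particular the
  sum or composite of two floor families, which need not be a floor family, is equivalent to one.\<close>

lemma eudoxus_hyper_class_floor_family:
  assumes "u \<in> almost_hom_families" and "\<And>n. slope (u n) = x n"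
  shows "eudoxus_hyper_rel U `` {u} = eudoxus_hyper_rel U `` {floor_family x}"
  using assms by (simp add: eudoxus_hyper_class_eq_iff)

text \<open>Addition and composition are two instances of one situation: an operation \<open>op\<close> on almost
  homomorphisms whose effect on slopes is a function \<open>F\<close> of the slopes.\<close>

lemma lift_op_floor_family:
  assumes closed: "\<And>f g. f \<in> almost_homs \<Longrightarrow> g \<in> almost_homs \<Longrightarrow> op f g \<in> almost_homs"
    and slope: "\<And>f g. f \<in> almost_homs \<Longrightarrow> g \<in> almost_homs \<Longrightarrow> slope (op f g) = F (slope f) (slope g)"
  shows "lift_op (eudoxus_hyper_rel U) (\<lambda>u v n. op (u n) (v n))
      (eudoxus_hyper_rel U `` {floor_family x}) (eudoxus_hyper_rel U `` {floor_family y}) =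
    eudoxus_hyper_rel U `` {floor_family (\<lambda>n. F (x n) (y n))}"
proof -
  let ?r = "eudoxus_hyper_rel U"
  have mem: "w n \<in> almost_homs" if "w \<in> almost_hom_families" for w n
    using that by (simp add: almost_hom_families_def)
  have fam: "(\<lambda>n. op (u n) (v n)) \<in> almost_hom_families"
    if "u \<in> almost_hom_families" "v \<in> almost_hom_families" for u v
    using mem[OF that(1)] mem[OF that(2)] closed by (simp add: almost_hom_families_def)
  have "((\<lambda>n. op (u n) (v n)), (\<lambda>n. op (u' n) (v' n))) \<in> ?r"
    if "(u, u') \<in> ?r" "(v, v') \<in> ?r" for u u' v v'
  proof -
    have in_fam: "u \<in> almost_hom_families" "u' \<in> almost_hom_families"
        "v \<in> almost_hom_families" "v' \<in> almost_hom_families"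
      and "\<forall>\<^sub>F n in U. slope (u n) = slope (u' n)" "\<forall>\<^sub>F n in U. slope (v n) = slope (v' n)"
      using that by (simp_all add: eudoxus_hyper_rel_iff)
    from this(5,6) have "\<forall>\<^sub>F n in U. slope (op (u n) (v n)) = slope (op (u' n) (v' n))"
      by eventually_elim (simp add: slope mem in_fam)
    then show ?thesis
      by (simp add: eudoxus_hyper_rel_iff fam in_fam)
  qed
  then have "lift_op ?r (\<lambda>u v n. op (u n) (v n)) (?r `` {floor_family x}) (?r `` {floor_family y})
      = ?r `` {\<lambda>n. op (floor_family x n) (floor_family y n)}"
    by (rule lift_op_class[OF equiv_eudoxus_hyper_rel floor_family_in floor_family_in])
  also have "\<dots> = ?r `` {floor_family (\<lambda>n. F (x n) (y n))}"
    by (rule eudoxus_hyper_class_floor_family) (simp_all add: fam slope mem)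
  finally show ?thesis .
qed

lemma eudoxus_hyperreals_is_model:
  assumes "ultrafilter U"
  shows "real_ultrapower_model U (eudoxus_hyperreals U)
    (\<lambda>x. eudoxus_hyper_rel U `` {floor_family x})"
proof
  let ?r = "eudoxus_hyper_rel U"
  let ?cls = "\<lambda>x. ?r `` {floor_family x}"
  show "ultrafilter U" by (rule assms)
  show "carrier (eudoxus_hyperreals U) = range ?cls"
  proof (rule Set.set_eqI)
    fix X
    have "X \<in> range ?cls" if "u \<in> almost_hom_families" "X = ?r `` {u}" for u
      using that eudoxus_hyper_class_floor_family[of u "\<lambda>n. slope (u n)"] by blast
    moreover have "?cls x \<in> almost_hom_families // ?r" for x
      by (rule quotientI) simp
    ultimately show "X \<in> carrier (eudoxus_hyperreals U) \<longleftrightarrow> X \<in> range ?cls"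
      unfolding eudoxus_hyperreals_def partial_object.simps by (blast elim: quotientE)
  qed
  show "\<zero>\<^bsub>eudoxus_hyperreals U\<^esub> = ?cls (\<lambda>n. 0)"
    by (simp add: eudoxus_hyperreals_def floor_family_def[abs_def])
  show "\<one>\<^bsub>eudoxus_hyperreals U\<^esub> = ?cls (\<lambda>n. 1)"
    by (simp add: eudoxus_hyperreals_def floor_family_def[abs_def])
  fix x y
  show "?cls x = ?cls y \<longleftrightarrow> (\<forall>\<^sub>F n in U. x n = y n)"
    by (simp add: eudoxus_hyper_class_eq_iff)
  show "?cls x \<prec>\<^bsub>eudoxus_hyperreals U\<^esub> ?cls y \<longleftrightarrow> (\<forall>\<^sub>F n in U. x n < y n)"
    by (simp add: eudoxus_hyper_less_iff)
  show "?cls x \<oplus>\<^bsub>eudoxus_hyperreals U\<^esub> ?cls y = ?cls (\<lambda>n. x n + y n)"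
    unfolding eudoxus_hyperreals_def ring_record_simps
    by (rule lift_op_floor_family[where op = "\<lambda>f g a. f a + g a" and F = "(+)"])
      (simp_all add: almost_homs_add slope_add)
  show "?cls x \<otimes>\<^bsub>eudoxus_hyperreals U\<^esub> ?cls y = ?cls (\<lambda>n. x n * y n)"
    unfolding eudoxus_hyperreals_def monoid.simps
    by (rule lift_op_floor_family[where op = "(\<circ>)" and F = "(*)"])
      (simp_all add: almost_homs_comp slope_comp)
qed

theorem theorem4p1:
  fixes U :: "nat filter"
  assumes "ultrafilter U"
  shows "ordered_field_embedding real_ordered_field (eudoxus_hyperreals U)
           (\<lambda>r::real. eudoxus_hyper_rel U `` {\<lambda>(n::nat) (a::int). \<lfloor>r * of_int a\<rfloor>})
       \<and> (\<exists>\<phi>. ordered_field_iso (eudoxus_hyperreals U) (real_ultrapower U) \<phi>)"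
proof
  note model = eudoxus_hyperreals_is_model[OF assms]
  show "ordered_field_embedding real_ordered_field (eudoxus_hyperreals U)
      (\<lambda>r::real. eudoxus_hyper_rel U `` {\<lambda>(n::nat) (a::int). \<lfloor>r * of_int a\<rfloor>})"
    using real_ultrapower_model.constant_embedding[OF model]
    by (simp add: floor_family_def[abs_def])
  show "\<exists>\<phi>. ordered_field_iso (eudoxus_hyperreals U) (real_ultrapower U) \<phi>"
    by (rule real_ultrapower_models_iso[OF model real_ultrapower_is_model[OF assms]])
qed

end
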